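(* Let $0<k\le 1$, let $a_1,\dots,a_n$ be points with $|a_j|>1$, and let $w(z)=\prod_{j=1}^n(z-a_j)$. Suppose $r(z)=\frac{p(z)}{w(z)}\in\Re_n(a_1,\dots,a_n)$ has exactly $n$ poles, at $a_1,\dots,a_n$, and all its zeros lie in $\{|z|\le k\}$, with a zero of order $s$ at the origin; that is, $p(z)=c_mz^s\prod_{j=1}^{m-s}(z-b_j)=z^s\left(c_s+c_{s+1}z+\dots+c_mz^{m-s}\right)$ with $c_m\neq 0$, $m\le n$, $|b_j|\le k\le 1$ for $j=1,\dots,m-s$, where $m$ is the number of zeros of $r$. Then for all $z$ with $|z|=1$, $$|r'(z)|\ge\frac12\left\{|B'(z)|-n+\frac{2(m+sk)}{1+k}+\frac{2k}{k+1}\left(\frac{k^{m}|c_m|-|c_s|}{k^{m}|c_m|+|c_s|}\right)\right\}|r(z)|.$$ The result is sharp: equality holds at $z=1$ for $r(z)=\frac{z^s(z+k)^{m-s}}{(z-a)^n}$ and $B(z)=\left(\frac{1-az}{z-a}\right)^n$, where $m\le n$ and $k\le 1<a$.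
   Context: For points $a_1,\dots,a_n$ (not necessarily distinct) with $|a_j|>1$ and $w(z)=\prod_{j=1}^n(z-a_j)$, $\Re_n=\Re_n(a_1,\dots,a_n)$ is the set of rational functions $p/w$ where $p$ is a complex polynomial of degree at most $n$. The Blaschke product is $B(z)=\frac{w^*(z)}{w(z)}=\prod_{j=1}^n\frac{1-\overline{a_j}z}{z-a_j}$, where $w^*(z)=z^n\overline{w(1/\overline z)}$. Poles and zeros are counted with multiplicity. "Zero of order $s$ at the origin" means exactly order $s$, so the $b_j$ are the nonzero zeros of $r$ and $c_s\ne 0$.
   Formalization: The sharpness claim is false as printed when s ≥ 1 and k < 1 (e.g. n = m = s = 1, k = 1/2, a = 2); it is replaced by: for the given r and B, equality at z = 1 holds if and only if s = 0 or k = 1. The inequality itself is proved as printed. *)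

theory Defs
  imports "HOL-Complex_Analysis.Complex_Analysis" "HOL-Computational_Algebra.Polynomial"
begin

definition pole_poly :: "nat \<Rightarrow> (nat \<Rightarrow> complex) \<Rightarrow> complex poly" where
  "pole_poly n a = (\<Prod>j=1..n. [:- a j, 1:])"

definition rational_space :: "nat \<Rightarrow> (nat \<Rightarrow> complex) \<Rightarrow> (complex \<Rightarrow> complex) set" where
  "rational_space n a =
     {r. \<exists>p. degree p \<le> n \<and> r = (\<lambda>z. poly p z / poly (pole_poly n a) z)}"

definition blaschke :: "nat \<Rightarrow> (nat \<Rightarrow> complex) \<Rightarrow> complex \<Rightarrow> complex" where
  "blaschke n a z = (\<Prod>j=1..n. (1 - cnj (a j) * z) / (z - a j))"

text \<open>The product agrees with \<open>w\<^sup>*(z) / w(z)\<close>, where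
  \<open>w\<^sup>*(z) = z\<^sup>n cnj (w (1 / cnj z))\<close>; the latter expression only makes sense literally
  for \<open>z \<noteq> 0\<close>.\<close>

lemma blaschke_eq:
  assumes "z \<noteq> 0"
  shows "blaschke n a z =
    z ^ n * cnj (poly (pole_poly n a) (1 / cnj z)) / poly (pole_poly n a) z"
proof -
  have "(\<Prod>j=1..n. 1 - cnj (a j) * z) = (\<Prod>j=1..n. z * cnj (1 / cnj z - a j))"
    using assms by (intro prod.cong) (auto simp: field_simps)
  also have "\<dots> = z ^ n * cnj (poly (pole_poly n a) (1 / cnj z))"
    by (simp add: pole_poly_def poly_prod prod.distrib)
  finally show ?thesis
    by (simp add: blaschke_def pole_poly_def poly_prod prod_dividef)
qed

text \<open>The \<open>a j\<close> need not be distinct, so the order of a pole is the number of indices at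
  which it occurs.\<close>

definition has_exactly_poles :: "(complex \<Rightarrow> complex) \<Rightarrow> nat \<Rightarrow> (nat \<Rightarrow> complex) \<Rightarrow> bool" where
  "has_exactly_poles r n a \<longleftrightarrow>
     {z. is_pole r z} = a ` {1..n} \<and>
     (\<forall>z \<in> a ` {1..n}. zorder r z = - int (card {j \<in> {1..n}. a j = z}))"

text \<open>The functions \<open>r = p / w\<close> under consideration: \<open>s\<close> is the exact order of the zero at the
  origin (hence \<open>b j \<noteq> 0\<close>), and \<open>m\<close> is the number of zeros of \<open>r\<close>, counted with multiplicity.
  The numbers \<open>c\<^sub>s, \<dots>, c\<^sub>m\<close> are the coefficients of \<open>p\<close>.\<close>

definition zeros_in_disc ::
  "real \<Rightarrow> nat \<Rightarrow> nat \<Rightarrow> nat \<Rightarrow> (nat \<Rightarrow> complex) \<Rightarrow> complex poly \<Rightarrow> (complex \<Rightarrow> complex) \<Rightarrow> bool"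
where
  "zeros_in_disc k n m s a p r \<longleftrightarrow>
     (\<forall>j \<in> {1..n}. norm (a j) > 1) \<and>
     r = (\<lambda>z. poly p z / poly (pole_poly n a) z) \<and>
     r \<in> rational_space n a \<and>
     has_exactly_poles r n a \<and>
     s \<le> m \<and> m \<le> n \<and> coeff p m \<noteq> 0 \<and>
     (\<exists>b. (\<forall>j \<in> {1..m - s}. b j \<noteq> 0 \<and> norm (b j) \<le> k) \<and>
          p = smult (coeff p m) (monom 1 s * (\<Prod>j=1..m - s. [:- b j, 1:])))"

text \<open>On sharpness: for \<open>p = z\<^sup>s (z + k) ^ (m - s)\<close> one has \<open>c\<^sub>m = 1\<close> and
  \<open>c\<^sub>s = k ^ (m - s)\<close>. The quotient \<open>(k ^ m |c\<^sub>m| - |c\<^sub>s|) / (k ^ m |c\<^sub>m| + |c\<^sub>s|)\<close> in the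
  bound is then zero if \<open>s = 0\<close> or \<open>k = 1\<close> and negative otherwise, while the other terms
  of the bound at \<open>z = 1\<close> already add up to \<open>|r' 1|\<close>. So the functions
  \<open>z\<^sup>s (z + k) ^ (m - s) / (z - \<alpha>) ^ n\<close> attain equality exactly when \<open>s = 0\<close> or \<open>k = 1\<close>,
  and sharpness is stated in this form.\<close>

lemma extremal_quotient_eq_0_iff:
  fixes k :: real
  assumes "0 < k" "k \<le> 1" "s \<le> m"
  shows "(k ^ m - k ^ (m - s)) / (k ^ m + k ^ (m - s)) = 0 \<longleftrightarrow> s = 0 \<or> k = 1"
proof -
  have pos: "k ^ m + k ^ (m - s) > 0" "k ^ (m - s) > 0"
    using assms by (auto intro: add_pos_pos)
  have split: "k ^ m = k ^ (m - s) * k ^ s"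
    using assms by (simp flip: power_add)
  have "(k ^ m - k ^ (m - s)) / (k ^ m + k ^ (m - s)) = 0 \<longleftrightarrow> k ^ s = 1"
    using pos assms(1) by (simp add: split)
  also have "\<dots> \<longleftrightarrow> s = 0 \<or> k = 1"
    using assms by (metis gr0I less_le power_0 power_one power_less_one_iff)
  finally show ?thesis .
qed

end

theory Submission
  imports Defs
begin

text \<open>On the unit circle, \<open>|r' / r| \<ge> Re (z r' / r)\<close>, and the logarithmic derivative splits into
  \<open>s + \<Sum> Re (z / (z - b\<^sub>j)) - \<Sum> Re (z / (z - a\<^sub>j))\<close>.  The sum over the poles is
  \<open>(n - |B'|) / 2\<close> exactly, and each zero contributes at least \<open>1 / (1 + |b\<^sub>j|)\<close>.  With
  \<open>t\<^sub>j = |b\<^sub>j| / k \<le> 1\<close> one has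
  \<open>1 / (1 + k t) - 1 / (1 + k) \<ge> k / (1 + k) (1 - t) / (1 + t)\<close>, and \<open>(1 - t) / (1 + t)\<close> is
  subadditive with respect to products, so that the zeros yield a term in \<open>\<Prod> t\<^sub>j\<close>, which is
  \<open>|c\<^sub>s| / (k\<^bsup>m-s\<^esup> |c\<^sub>m|)\<close>.\<close>

section \<open>Real parts of \<open>z / (z - a)\<close> on the unit circle\<close>

lemma Re_div_diff_unit:
  assumes "norm z = 1" "z \<noteq> a"
  shows "Re (z / (z - a)) = 1/2 - (norm a ^ 2 - 1) / (2 * norm (z - a) ^ 2)"
proof -
  have sq: "norm (z - a) ^ 2 = (Re z - Re a)^2 + (Im z - Im a)^2"
    by (simp add: cmod_power2)
  have pos: "(Re z - Re a)^2 + (Im z - Im a)^2 \<noteq> 0"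
    using assms(2) by (auto simp: sum_power2_eq_zero_iff complex_eq_iff)
  have z1: "(Re z)^2 + (Im z)^2 = 1"
    using assms(1) by (metis cmod_power2 power_one)
  have "Re (z / (z - a)) = (Re z * (Re z - Re a) + Im z * (Im z - Im a)) /
      ((Re z - Re a)^2 + (Im z - Im a)^2)"
    by (simp add: Re_divide)
  \<comment> \<open>Polarization: 2 Re (z cnj (z - a)) = |z|^2 + |z - a|^2 - |a|^2, with |z| =
    1.\<close>
  also have "Re z * (Re z - Re a) + Im z * (Im z - Im a) =
      (((Re z - Re a)^2 + (Im z - Im a)^2) - (norm a ^ 2 - 1)) / 2"
    using z1 unfolding cmod_power2[of a] by (simp add: power2_eq_square algebra_simps)
  also have "\<dots> / ((Re z - Re a)^2 + (Im z - Im a)^2) = 1/2 - (norm a ^ 2 - 1) / (2 * norm (z - a) ^ 2)"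
  proof -
    have "(D - E) / 2 / D = 1/2 - E / (2 * D)" if "D \<noteq> 0" for D E :: real
      using that by (simp add: field_simps)
    from this[OF pos] show ?thesis unfolding sq .
  qed
  finally show ?thesis .
qed

text \<open>For |b| \<le> 1 the deviation of the real part from 1/2 is (1 - |b|^2) / (2 |z - b|^2),
  which is nonnegative and decreases as |z - b| grows. Its minimum is at the largest possible
  distance 1 + |b|, where the value is 1/2 + (1 - |b|) / (2 (1 + |b|)) = 1 / (1 + |b|).\<close>

lemma Re_div_diff_ge:
  assumes "norm z = 1" "z \<noteq> b" "norm b \<le> 1"
  shows "Re (z / (z - b)) \<ge> 1 / (1 + norm b)"
proof -
  have d: "0 < norm (z - b)" "norm (z - b) \<le> 1 + norm b"
    using assms norm_triangle_ineq4[of z b] by auto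
  have sq: "norm (z - b) ^ 2 \<le> (1 + norm b) ^ 2"
    using d by (intro power_mono) auto
  have "1 / (1 + norm b) = 1/2 + (1 - norm b ^ 2) / (2 * (1 + norm b) ^ 2)"
    using norm_ge_zero[of b]
    by (simp add: divide_simps add_pos_nonneg[THEN less_imp_neq[symmetric]])
       (simp add: power2_eq_square algebra_simps)
  also have "\<dots> \<le> 1/2 + (1 - norm b ^ 2) / (2 * norm (z - b) ^ 2)"
    using sq d assms(3) by (intro add_mono divide_left_mono mult_pos_pos) (auto simp: power_le_one add_pos_nonneg)
  also have "\<dots> = Re (z / (z - b))"
    using Re_div_diff_unit[OF assms(1,2)] by (simp add: diff_divide_distrib)
  finally show ?thesis .
qed

section \<open>The Blaschke product and the contribution of the poles\<close>

text \<open>On the circle every factor is unimodular and has logarithmic derivative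
  \<open>t j / z\<close> with \<open>t j\<close> a positive real. All these share the phase of 1 /
  z, so they add without cancellation and the modulus of the sum is the sum of the
  \<open>t j\<close>.\<close>

lemma norm_deriv_blaschke:
  assumes "norm z = 1" "\<And>j. j \<in> {1..n} \<Longrightarrow> norm (a j) > 1"
  shows "norm (deriv (blaschke n a) z) = (\<Sum>j=1..n. (norm (a j) ^ 2 - 1) / norm (z - a j) ^ 2)"
proof -
  define f where "f = (\<lambda>j u. (1 - cnj (a j) * u) / (u - a j))"
  define t where "t = (\<lambda>j. (norm (a j) ^ 2 - 1) / norm (z - a j) ^ 2)"
  have zz: "z * cnj z = 1"
    using assms(1) by (simp add: complex_norm_square[symmetric])
  have ne: "z - a j \<noteq> 0" if "j \<in> {1..n}" for j
    using assms(1) assms(2)[OF that] by auto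
  \<comment> \<open>Writing 1 as \<open>z * cnj z\<close> makes the numerator a reflection of the
    denominator. This gives both the modulus 1 and the form of the logarithmic derivative.\<close>
  have num: "1 - cnj (a j) * z = z * cnj (z - a j)" for j
    using zz by (simp add: algebra_simps)
  have normf: "norm (f j z) = 1" if "j \<in> {1..n}" for j
    using ne[OF that] assms(1) by (simp only: f_def num norm_divide norm_mult complex_mod_cnj) simp
  have t: "complex_of_real (t j) = (a j * cnj (a j) - 1) / ((z - a j) * cnj (z - a j))" for j
    by (simp only: t_def of_real_divide of_real_diff of_real_1 complex_norm_square)
  have z0: "z \<noteq> 0" using assms(1) by auto
  have der: "(f j has_field_derivative of_real (t j) / z * f j z) (at z)" if "j \<in> {1..n}" for j
  proof -
    have "(f j has_field_derivative
        ((- cnj (a j)) * (z - a j) - (1 - cnj (a j) * z)) / ((z - a j) * (z - a j))) (at z)"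
      unfolding f_def using ne[OF that] by (auto intro!: derivative_eq_intros)
    also have "(- cnj (a j)) * (z - a j) - (1 - cnj (a j) * z) = a j * cnj (a j) - 1"
      by (simp add: algebra_simps)
    also have "(a j * cnj (a j) - 1) / ((z - a j) * (z - a j)) = of_real (t j) / z * f j z"
    proof -
      have "cnj (z - a j) \<noteq> 0" using ne[OF that] by (metis complex_cnj_zero_iff)
      then show ?thesis
        unfolding t f_def num using ne[OF that] z0 by (simp add: divide_simps)
    qed
    finally show ?thesis .
  qed
  have nz: "f j z \<noteq> 0" if "j \<in> {1..n}" for j using normf[OF that] by auto
  have "(blaschke n a has_field_derivative
      (\<Prod>j=1..n. f j z) * (\<Sum>j=1..n. (of_real (t j) / z * f j z) / f j z)) (at z)"
    unfolding blaschke_def[abs_def] f_def[symmetric]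
    using has_field_derivative_prod'[of "{1..n}" f z, OF nz der] by (simp add: f_def)
  then have "deriv (blaschke n a) z = (\<Prod>j=1..n. f j z) * (\<Sum>j=1..n. (of_real (t j) / z * f j z) / f j z)"
    by (rule DERIV_imp_deriv)
  also have "(\<Sum>j=1..n. (of_real (t j) / z * f j z) / f j z) = of_real (\<Sum>j=1..n. t j) / z"
    using nz by (simp add: sum_divide_distrib)
  finally have "norm (deriv (blaschke n a) z) = \<bar>\<Sum>j=1..n. t j\<bar>"
    using normf assms(1) by (simp add: norm_mult norm_divide prod_norm[symmetric] del: of_real_sum)
  also have "\<dots> = (\<Sum>j=1..n. t j)"
    using assms(2) by (intro abs_of_nonneg sum_nonneg) (auto simp: t_def one_le_power less_imp_le)
  finally show ?thesis unfolding t_def .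
qed

text \<open>The deviations of the real parts from 1/2 are exactly half the summands of |B'|, so the
  poles enter the estimate without any loss.\<close>

lemma sum_Re_poles:
  assumes "norm z = 1" "\<And>j. j \<in> {1..n} \<Longrightarrow> norm (a j) > 1"
  shows "(\<Sum>j=1..n. Re (z / (z - a j))) = (real n - norm (deriv (blaschke n a) z)) / 2"
proof -
  have "(\<Sum>j=1..n. Re (z / (z - a j))) =
      (\<Sum>j=1..n. 1/2 - 1/2 * ((norm (a j) ^ 2 - 1) / norm (z - a j) ^ 2))"
  proof (intro sum.cong refl)
    fix j assume "j \<in> {1..n}"
    then have "z \<noteq> a j" using assms by force
    then show "Re (z / (z - a j)) = 1/2 - 1/2 * ((norm (a j) ^ 2 - 1) / norm (z - a j) ^ 2)"
      using Re_div_diff_unit[OF assms(1)] by simp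
  qed
  also have "\<dots> = (real n - norm (deriv (blaschke n a) z)) / 2"
    using norm_deriv_blaschke[of z n a, OF assms]
    by (simp only: sum_subtractf sum_distrib_left[symmetric]) (simp add: field_simps)
  finally show ?thesis .
qed

section \<open>Real inequalities for the zeros\<close>

text \<open>Two factors suffice, by induction. There (1 - x) / (1 + x) + (1 - y) / (1 + y) = 2 (1 -
  xy) / ((1 + x) (1 + y)), and (1 + x) (1 + y) \<le> 2 (1 + xy) is a rearrangement of (1 - x) (1 -
  y) \<ge> 0.\<close>

lemma sum_Cayley_ge_Cayley_prod:
  fixes t :: "'a \<Rightarrow> real"
  assumes "finite A" "\<And>j. j \<in> A \<Longrightarrow> 0 \<le> t j \<and> t j \<le> 1"
  shows "(1 - prod t A) / (1 + prod t A) \<le> (\<Sum>j\<in>A. (1 - t j) / (1 + t j))"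
  using assms
proof (induction A rule: finite_induct)
  case (insert i A)
  define x y where "x = t i" and "y = prod t A"
  have x: "0 \<le> x" "x \<le> 1" and y: "0 \<le> y" "y \<le> 1"
    using insert.prems by (auto simp: x_def y_def intro!: prod_nonneg prod_le_1)
  have xy: "x * y \<le> 1" "0 \<le> x * y" using x y by (auto simp: mult_le_one)
  have "0 \<le> (1 - x) * (1 - y)" using x y by simp
  then have "(1 + x) * (1 + y) \<le> 2 * (1 + x * y)" by (simp add: algebra_simps)
  then have "(1 - x * y) / (2 * (1 + x * y)) \<le> (1 - x * y) / ((1 + x) * (1 + y))"
    using x y xy by (intro divide_left_mono mult_pos_pos add_pos_nonneg) auto
  moreover have "u / v \<le> 2 * u / w" if "u / (2 * v) \<le> u / w" for u v w :: real
    using that by simp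
  ultimately have "(1 - x * y) / (1 + x * y) \<le> 2 * (1 - x * y) / ((1 + x) * (1 + y))"
    by blast
  also have "\<dots> = (1 - x) / (1 + x) + (1 - y) / (1 + y)"
    using x y by (simp add: divide_simps) (simp add: algebra_simps)
  also have "\<dots> \<le> (1 - x) / (1 + x) + (\<Sum>j\<in>A. (1 - t j) / (1 + t j))"
    using insert.IH insert.prems by (simp add: y_def)
  finally show ?case using insert.hyps by (simp add: x_def y_def)
qed simp

text \<open>To be applied with \<open>\<beta> j = norm (b j)\<close>. The exponent
  \<open>N + s\<close> is the number m of all zeros, including those at the origin, as in the
  coefficient quotient of the theorem. The argument first yields the stronger quotient with exponent
  \<open>N\<close>, which is (1 - Q) / (1 + Q).\<close>

lemma sum_inverse_one_plus_ge:
  fixes k :: real and \<beta> :: "nat \<Rightarrow> real"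
  assumes k: "0 < k" "k \<le> 1" and \<beta>: "\<And>j. j \<in> {1..N} \<Longrightarrow> 0 \<le> \<beta> j \<and> \<beta> j \<le> k"
  shows "(\<Sum>j=1..N. 1 / (1 + \<beta> j)) \<ge> real N / (1 + k)
    + k / (k + 1) * ((k ^ (N + s) - (\<Prod>j=1..N. \<beta> j)) / (k ^ (N + s) + (\<Prod>j=1..N. \<beta> j)))"
proof -
  define t where "t j = \<beta> j / k" for j
  define Q where "Q = (\<Prod>j=1..N. t j)"
  have t: "0 \<le> t j \<and> t j \<le> 1" if "j \<in> {1..N}" for j
    using \<beta>[OF that] k by (auto simp: t_def)
  have Q: "Q \<ge> 0" unfolding Q_def by (intro prod_nonneg) (use t in auto)
  have \<beta>_eq: "(\<Prod>j=1..N. \<beta> j) = k ^ N * Q"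
    using k by (simp add: Q_def t_def prod_dividef)
  have ks: "0 < k ^ s" "k ^ s \<le> 1" using k by (auto simp: power_le_one)
  have "(k ^ (N + s) - k ^ N * Q) / (k ^ (N + s) + k ^ N * Q) = (k ^ s - Q) / (k ^ s + Q)"
    using k by (simp add: power_add flip: right_diff_distrib distrib_left)
  \<comment> \<open>(x - Q) / (x + Q) is nondecreasing in x > 0 and \<open>k ^ s \<le> 1\<close>.
    For Q > 0 the inequality is strict unless \<open>k ^ s = 1\<close>, which is where the extremal
    functions with s > 0 and k < 1 lose equality.\<close>
  also have "\<dots> \<le> (1 - Q) / (1 + Q)"
  proof -
    have "(k ^ s - Q) * (1 + Q) \<le> (1 - Q) * (k ^ s + Q)"
      using mult_right_mono[OF ks(2) Q] by (simp add: algebra_simps)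
    then show ?thesis using ks Q by (simp add: frac_le_eq divide_simps)
  qed
  also have "\<dots> \<le> (\<Sum>j=1..N. (1 - t j) / (1 + t j))"
    unfolding Q_def by (rule sum_Cayley_ge_Cayley_prod) (use t in auto)
  finally have "k / (k + 1) * ((k ^ (N + s) - k ^ N * Q) / (k ^ (N + s) + k ^ N * Q))
      \<le> k / (k + 1) * (\<Sum>j=1..N. (1 - t j) / (1 + t j))"
    using k by (intro mult_left_mono) auto
  also have "\<dots> = (\<Sum>j=1..N. k / (k + 1) * ((1 - t j) / (1 + t j)))"
    by (rule sum_distrib_left)
  also have "\<dots> \<le> (\<Sum>j=1..N. 1 / (1 + \<beta> j) - 1 / (1 + k))"
  proof (intro sum_mono)
    fix j assume j: "j \<in> {1..N}"
    have b: "\<beta> j = k * t j" using k by (simp add: t_def)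
    \<comment> \<open>The difference of reciprocals equals k (1 - t) / ((k + 1) (1 + k t)).
      Enlarging k t to t in the denominator produces the Cayley term.\<close>
    have "k * t j \<le> t j" using t[OF j] k by (simp add: mult_left_le_one_le)
    then have "k * (1 - t j) / ((k + 1) * (1 + t j)) \<le> k * (1 - t j) / ((k + 1) * (1 + k * t j))"
      using t[OF j] k by (intro divide_left_mono mult_left_mono mult_pos_pos mult_nonneg_nonneg add_pos_nonneg) auto
    also have "\<dots> = 1 / (1 + \<beta> j) - 1 / (1 + k)"
    proof -
      have "1 + k * t j \<noteq> 0" "1 + k \<noteq> 0" "k + 1 \<noteq> 0"
        using t[OF j] k by (auto simp: add_pos_nonneg less_imp_neq[symmetric])
      then show ?thesis unfolding b by (simp add: divide_simps) (simp add: algebra_simps)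
    qed
    finally show "k / (k + 1) * ((1 - t j) / (1 + t j)) \<le> 1 / (1 + \<beta> j) - 1 / (1 + k)"
      by simp
  qed
  finally show ?thesis unfolding \<beta>_eq by (simp add: sum_subtractf)
qed

section \<open>Logarithmic derivative and the lower bound\<close>

text \<open>Multiplying the logarithmic derivative by z turns the zero at the origin into the
  constant \<open>s\<close> and every other summand into the shape \<open>z / (z - c)\<close> whose
  real part is controlled on the circle.\<close>

lemma deriv_rational:
  fixes r :: "complex \<Rightarrow> complex"
  assumes r: "r = (\<lambda>z. poly p z / poly (pole_poly n a) z)"
    and p: "p = smult c (monom 1 s * (\<Prod>j=1..N. [:- b j, 1:]))"
    and z: "z \<noteq> 0" "\<And>j. j \<in> {1..N} \<Longrightarrow> z \<noteq> b j" "\<And>j. j \<in> {1..n} \<Longrightarrow> z \<noteq> a j"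
  shows "z * deriv r z =
    r z * (of_nat s + (\<Sum>j=1..N. z / (z - b j)) - (\<Sum>j=1..n. z / (z - a j)))"
proof -
  let ?P = "\<lambda>u. \<Prod>j=1..N. u - b j" and ?W = "\<lambda>u. \<Prod>j=1..n. u - a j"
  have r': "r = (\<lambda>u. c * (u ^ s * ?P u) / ?W u)"
    unfolding r p by (simp add: pole_poly_def poly_prod poly_monom)
  have P: "(?P has_field_derivative ?P z * (\<Sum>j=1..N. 1 / (z - b j))) (at z)"
    by (rule has_field_derivative_prod') (use z in \<open>auto intro!: derivative_eq_intros\<close>)
  have W: "(?W has_field_derivative ?W z * (\<Sum>j=1..n. 1 / (z - a j))) (at z)"
    by (rule has_field_derivative_prod') (use z in \<open>auto intro!: derivative_eq_intros\<close>)
  have W0: "?W z \<noteq> 0" using z by auto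
  have "(r has_field_derivative
      (c * (of_nat s * z ^ (s - 1) * ?P z + z ^ s * (?P z * (\<Sum>j=1..N. 1 / (z - b j)))) * ?W z
        - c * (z ^ s * ?P z) * (?W z * (\<Sum>j=1..n. 1 / (z - a j)))) / (?W z * ?W z)) (at z)"
    unfolding r' by (rule derivative_eq_intros P W W0 refl | simp add: algebra_simps)+
  then have "deriv r z =
      (c * (of_nat s * z ^ (s - 1) * ?P z + z ^ s * (?P z * (\<Sum>j=1..N. 1 / (z - b j)))) * ?W z
        - c * (z ^ s * ?P z) * (?W z * (\<Sum>j=1..n. 1 / (z - a j)))) / (?W z * ?W z)"
    by (rule DERIV_imp_deriv)
  also have "\<dots> = r z * (of_nat s / z + (\<Sum>j=1..N. 1 / (z - b j)) - (\<Sum>j=1..n. 1 / (z - a j)))"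
  proof -
    \<comment> \<open>For \<open>s = 0\<close> the exponent \<open>s - 1\<close> is truncated to 0,
      but the factor \<open>of_nat s\<close> makes both sides vanish.\<close>
    have e: "of_nat s * z ^ (s - 1) = of_nat s * z ^ s / z"
      using z(1) by (cases s) auto
    have "(c * (e * P + E * (P * X)) * W - c * (E * P) * (W * Y)) / (W * W)
        = c * (E * P) / W * (of_nat s / z + X - Y)"
      if "W \<noteq> 0" "e = of_nat s * E / z" for e P E X W Y :: complex
      using that z(1) by (simp add: field_simps)
    from this[OF W0 e] show ?thesis
      unfolding r' .
  qed
  finally have "deriv r z = r z * (of_nat s / z + (\<Sum>j=1..N. 1 / (z - b j)) - (\<Sum>j=1..n. 1 / (z - a j)))" .
  then have "z * deriv r z = r z *
      (z * (of_nat s / z) + z * (\<Sum>j=1..N. 1 / (z - b j)) - z * (\<Sum>j=1..n. 1 / (z - a j)))"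
    by (simp only: distrib_left right_diff_distrib mult.left_commute)
  then show ?thesis using z(1) by (simp add: sum_distrib_left)
qed

text \<open>After splitting off z^s, the lowest coefficient is the value at 0 of the remaining
  product. This Vieta relation translates the coefficient quotient of the theorem into one in the
  product of the |b_j|.\<close>

lemma norm_coeff_lowest:
  fixes c :: complex
  assumes "p = smult c (monom 1 s * (\<Prod>j=1..N. [:- b j, 1:]))"
  shows "norm (coeff p s) = norm c * (\<Prod>j=1..N. norm (b j))"
proof -
  have "coeff p s = c * coeff (\<Prod>j=1..N. [:- b j, 1:]) 0"
    by (simp add: assms coeff_monom_mult)
  also have "coeff (\<Prod>j=1..N. [:- b j, 1:]) 0 = (\<Prod>j=1..N. - b j)"
    unfolding poly_0_coeff_0[symmetric] poly_prod by simp
  finally show ?thesis by (simp add: norm_mult prod_norm[symmetric])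
qed

lemma norm_deriv_rational_ge:
  assumes k: "0 < k" "k \<le> 1" and zd: "zeros_in_disc k n m s a p r" and z: "norm z = 1"
  shows "norm (deriv r z) \<ge>
             1 / 2 * (norm (deriv (blaschke n a) z) - real n
               + 2 * (real m + real s * k) / (1 + k)
               + 2 * k / (k + 1)
                   * ((k ^ m * norm (coeff p m) - norm (coeff p s))
                      / (k ^ m * norm (coeff p m) + norm (coeff p s))))
             * norm (r z)"
\<comment> \<open>Zeros may lie on the circle when k = 1. At such a point the right-hand side is
  zero; elsewhere division by \<open>r z\<close> is possible.\<close>
proof (cases "r z = 0")
  case False
  define N where "N = m - s"
  from zd obtain b where a: "\<And>j. j \<in> {1..n} \<Longrightarrow> norm (a j) > 1"
    and r: "r = (\<lambda>z. poly p z / poly (pole_poly n a) z)"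
    and sm: "s \<le> m" and c0: "coeff p m \<noteq> 0"
    and b: "\<And>j. j \<in> {1..N} \<Longrightarrow> norm (b j) \<le> k"
    and p: "p = smult (coeff p m) (monom 1 s * (\<Prod>j=1..N. [:- b j, 1:]))"
    unfolding zeros_in_disc_def N_def by blast
  have m: "m = N + s" using sm by (simp add: N_def)
  have za: "z \<noteq> a j" if "j \<in> {1..n}" for j using a[OF that] z by auto
  have "poly p z \<noteq> 0" using False by (auto simp: r)
  then have zb: "z \<noteq> b j" if "j \<in> {1..N}" for j
    by (subst (asm) p) (use that in \<open>auto simp: poly_prod\<close>)
  \<comment> \<open>\<open>L\<close> is z r'(z) / r(z). Since |z| = 1, its modulus is |r'(z)| /
    |r(z)|, and it is bounded below through its real part.\<close>
  define L where "L = of_nat s + (\<Sum>j=1..N. z / (z - b j)) - (\<Sum>j=1..n. z / (z - a j))"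
  define P where "P = (\<Prod>j=1..N. norm (b j))"
  have "z * deriv r z = r z * L"
    unfolding L_def by (rule deriv_rational[OF r p]) (use z za zb in auto)
  then have "norm (deriv r z) = norm (r z) * norm L"
    by (metis mult_1 norm_mult z)
  have quot: "(k ^ m * norm (coeff p m) - norm (coeff p s)) / (k ^ m * norm (coeff p m) + norm (coeff p s))
      = (k ^ (N + s) - P) / (k ^ (N + s) + P)"
  proof -
    have "norm (coeff p s) = P * norm (coeff p m)"
      using norm_coeff_lowest[OF p] by (simp add: P_def mult.commute)
    then show ?thesis
      using c0 by (simp add: m flip: left_diff_distrib distrib_right)
  qed
  have "real N / (1 + k) + k / (k + 1) * ((k ^ (N + s) - P) / (k ^ (N + s) + P))
      \<le> (\<Sum>j=1..N. 1 / (1 + norm (b j)))"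
    unfolding P_def by (rule sum_inverse_one_plus_ge) (use k b in auto)
  also have "\<dots> \<le> (\<Sum>j=1..N. Re (z / (z - b j)))"
    using b k zb z by (intro sum_mono Re_div_diff_ge) (auto intro: order_trans)
  finally have "real s + (real N / (1 + k) + k / (k + 1) * ((k ^ (N + s) - P) / (k ^ (N + s) + P)))
      - (real n - norm (deriv (blaschke n a) z)) / 2 \<le> Re L"
    using sum_Re_poles[of z n a, OF z a]
    by (simp only: L_def Re_sum plus_complex.sel minus_complex.sel complex_Re_of_nat)
  also have "real s + (real N / (1 + k) + k / (k + 1) * ((k ^ (N + s) - P) / (k ^ (N + s) + P)))
      - (real n - norm (deriv (blaschke n a) z)) / 2 =
      1 / 2 * (norm (deriv (blaschke n a) z) - real n + 2 * (real m + real s * k) / (1 + k)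
               + 2 * k / (k + 1) * ((k ^ (N + s) - P) / (k ^ (N + s) + P)))"
  proof -
    \<comment> \<open>With m = N + s, the s zeros at the origin count fully and the other N with
      weight 1 / (1 + k).\<close>
    have "real s + real N / (1 + k) = (real m + real s * k) / (1 + k)"
      using k by (simp add: m field_simps)
    then have "2 * (real m + real s * k) / (1 + k) = 2 * (real s + real N / (1 + k))"
      by simp
    moreover have "2 * k / (k + 1) * q = 2 * (k / (k + 1) * q)" for q
      by simp
    moreover have "S + (A + Q) - (u - v) / 2 = 1 / 2 * (v - u + X + Y)"
      if "X = 2 * (S + A)" "Y = 2 * Q" for S A Q X Y u v :: real
      using that by (simp add: field_simps)
    ultimately show ?thesis by metis
  qed
  finally have "1 / 2 * (norm (deriv (blaschke n a) z) - real n + 2 * (real m + real s * k) / (1 + k)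
      + 2 * k / (k + 1) * ((k ^ (N + s) - P) / (k ^ (N + s) + P))) \<le> norm L"
    using complex_Re_le_cmod order_trans by blast
  then show ?thesis
    unfolding quot \<open>norm (deriv r z) = norm (r z) * norm L\<close>
    by (subst mult.commute) (rule mult_left_mono, auto)
qed simp

section \<open>The extremal functions\<close>

text \<open>Since the numerator does not vanish at \<open>\<alpha>\<close>, nothing cancels and the
  pole has order exactly \<open>n\<close>. For \<open>n = 0\<close> there is no pole, in agreement
  with the empty index set.\<close>

lemma has_exactly_poles_single:
  assumes f: "f holomorphic_on UNIV" "f \<alpha> \<noteq> 0"
  shows "has_exactly_poles (\<lambda>z. f z / (z - \<alpha>) ^ n) n (\<lambda>_. \<alpha>)"
proof -
  let ?r = "\<lambda>z. f z / (z - \<alpha>) ^ n"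
  have "\<not> is_pole ?r z" if "z \<noteq> \<alpha>" for z
    by (rule not_is_pole_holomorphic[of "- {\<alpha>}"])
       (use that in \<open>auto intro!: holomorphic_intros holomorphic_on_subset[OF f(1)]\<close>)
  moreover have "is_pole ?r \<alpha> \<longleftrightarrow> n > 0"
  proof (cases "n = 0")
    case True
    then show ?thesis using not_is_pole_holomorphic[of UNIV \<alpha> f] f by simp
  next
    case False
    then show ?thesis using is_pole_basic[of f UNIV \<alpha> n] f by auto
  qed
  ultimately have "{z. is_pole ?r z} = (if n > 0 then {\<alpha>} else {})"
    by (auto simp del: power_eq_0_iff) metis+
  also have "\<dots> = (\<lambda>_. \<alpha>) ` {1..n}"
    by (simp add: image_constant_conv)
  finally have "{z. is_pole ?r z} = (\<lambda>_. \<alpha>) ` {1..n}" .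
  moreover have "zorder ?r \<alpha> = - int n"
    by (rule zorder_eqI[of UNIV _ f])
       (use f in \<open>auto simp: power_int_minus field_simps\<close>)
  moreover have "{j \<in> {1..n}. \<alpha> = \<alpha>} = {1..n}"
    by auto
  ultimately show ?thesis by (simp add: has_exactly_poles_def del: atLeastAtMost_iff)
qed

text \<open>At z = 1 the logarithmic derivative is a nonnegative real \<open>x\<close>, so passing
  to the real part costs nothing, and each zero -k contributes exactly 1 / (1 + k). The bound
  without its quotient term is therefore attained, which reduces sharpness to the vanishing of that
  term.\<close>

lemma norm_deriv_extremal_1:
  fixes k \<alpha> :: real and n s N :: nat
  assumes k: "0 < k" and \<alpha>: "\<alpha> > 1"
  defines "r \<equiv> (\<lambda>z :: complex. z ^ s * (z + of_real k) ^ N / (z - of_real \<alpha>) ^ n)"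
  shows "norm (deriv r 1) = 1 / 2 * (norm (deriv (blaschke n (\<lambda>_. complex_of_real \<alpha>)) 1) - real n
    + 2 * (real (N + s) + real s * k) / (1 + k)) * norm (r 1)" and "r 1 \<noteq> 0"
proof -
  define a where "a = (\<lambda>_ :: nat. complex_of_real \<alpha>)"
  define p where "p = smult 1 (monom 1 s * (\<Prod>j=1..N. [:- (- complex_of_real k), 1:]))"
  define x where "x = real s + real N / (1 + k) - real n / (1 - \<alpha>)"
  have r: "r = (\<lambda>z. poly p z / poly (pole_poly n a) z)"
    by (simp add: r_def p_def a_def pole_poly_def poly_monom poly_prod algebra_simps)
  have ne: "complex_of_real 1 \<noteq> - of_real k" "complex_of_real 1 \<noteq> of_real \<alpha>"
    using k \<alpha> by (simp_all only: of_real_minus[symmetric] of_real_eq_iff)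
  then show "r 1 \<noteq> 0" by (auto simp: r_def add_eq_0_iff)
  have "1 * deriv r 1 = r 1 * (of_nat s + (\<Sum>j=1..N. 1 / (1 - (- complex_of_real k))) - (\<Sum>j=1..n. 1 / (1 - a j)))"
    by (rule deriv_rational[OF r p_def]) (use ne in \<open>auto simp: a_def\<close>)
  also have "\<dots> = r 1 * of_real x"
    by (simp add: x_def a_def)
  finally have "norm (deriv r 1) = \<bar>x\<bar> * norm (r 1)" by (simp add: norm_mult)
  also have "\<bar>x\<bar> = x"
  proof -
    have "real n / (1 - \<alpha>) \<le> 0" "0 \<le> real N / (1 + k)"
      using k \<alpha> by (auto intro: divide_nonneg_neg)
    then show ?thesis by (simp add: x_def)
  qed
  also have "x = 1 / 2 * (norm (deriv (blaschke n a) 1) - real n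
      + 2 * (real (N + s) + real s * k) / (1 + k))"
  proof -
    have "(\<Sum>j=1..n. Re (1 / (1 - a j))) = (real n - norm (deriv (blaschke n a) 1)) / 2"
      by (rule sum_Re_poles) (use \<alpha> in \<open>auto simp: a_def\<close>)
    moreover have "1 / (1 - a j) = of_real (1 / (1 - \<alpha>))" for j
      by (simp add: a_def)
    ultimately have poles: "real n / (1 - \<alpha>) = (real n - norm (deriv (blaschke n a) 1)) / 2"
      by (simp only: Re_complex_of_real) simp
    have "real s + real N / (1 + k) = (real (N + s) + real s * k) / (1 + k)"
      using k by (simp add: field_simps)
    then have "2 * (real (N + s) + real s * k) / (1 + k) = 2 * (real s + real N / (1 + k))"
      by simp
    moreover have "y - (u - v) / 2 = 1 / 2 * (v - u + X)" if "X = 2 * y" for X y u v :: real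
      using that by (simp add: field_simps)
    ultimately show ?thesis unfolding x_def poles by metis
  qed
  finally show "norm (deriv r 1) = 1 / 2 * (norm (deriv (blaschke n (\<lambda>_. complex_of_real \<alpha>)) 1) - real n
    + 2 * (real (N + s) + real s * k) / (1 + k)) * norm (r 1)"
    by (simp add: a_def)
qed

lemma extremal_poly:
  fixes k :: real
  assumes "s \<le> m"
  defines "p \<equiv> monom 1 s * [:complex_of_real k, 1:] ^ (m - s)"
  shows "degree p = m" "coeff p m = 1" "coeff p s = of_real (k ^ (m - s))"
proof -
  have m0: "monom 1 s \<noteq> (0 :: complex poly)" by (simp add: monom_eq_0_iff)
  have d: "degree ([:complex_of_real k, 1:] ^ (m - s)) = m - s"
    by (simp add: degree_power_eq)
  show deg: "degree p = m"
    unfolding p_def using m0 assms(1) by (subst degree_mult_eq) (auto simp: d degree_monom_eq)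
  have "lead_coeff p = 1"
    by (simp add: p_def lead_coeff_mult lead_coeff_power degree_monom_eq)
  then show "coeff p m = 1" by (simp add: deg)
  have "coeff p s = coeff ([:complex_of_real k, 1:] ^ (m - s)) 0"
    by (simp add: p_def coeff_monom_mult)
  then show "coeff p s = of_real (k ^ (m - s))"
    by (simp flip: poly_0_coeff_0)
qed

lemma zeros_in_disc_extremal:
  fixes k \<alpha> :: real
  assumes "0 < k" "s \<le> m" "m \<le> n" "\<alpha> > 1"
  shows "zeros_in_disc k n m s (\<lambda>_. complex_of_real \<alpha>)
    (monom 1 s * [:complex_of_real k, 1:] ^ (m - s))
    (\<lambda>z. z ^ s * (z + of_real k) ^ (m - s) / (z - of_real \<alpha>) ^ n)"
proof -
  let ?p = "monom 1 s * [:complex_of_real k, 1:] ^ (m - s)"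
  let ?a = "\<lambda>_ :: nat. complex_of_real \<alpha>"
  let ?r = "\<lambda>z. z ^ s * (z + complex_of_real k) ^ (m - s) / (z - of_real \<alpha>) ^ n"
  note p = extremal_poly[OF assms(2), of k]
  have r: "?r = (\<lambda>z. poly ?p z / poly (pole_poly n ?a) z)"
    by (simp add: pole_poly_def poly_monom algebra_simps)
  \<comment> \<open>Together with \<open>\<alpha> > 1\<close> this keeps the numerator nonzero at
    \<open>\<alpha>\<close>, so that the pole there has full order.\<close>
  have "complex_of_real \<alpha> + of_real k \<noteq> 0"
    using assms by (simp only: of_real_add[symmetric] of_real_eq_0_iff)
  then have "has_exactly_poles ?r n ?a"
    using assms by (intro has_exactly_poles_single) (auto intro!: holomorphic_intros)
  moreover have "?r \<in> rational_space n ?a"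
    unfolding rational_space_def r using p(1) assms(3) by (intro CollectI exI[of _ ?p] conjI refl) simp
  moreover have "\<exists>b. (\<forall>j \<in> {1..m - s}. b j \<noteq> 0 \<and> norm (b j) \<le> k) \<and>
          ?p = smult (coeff ?p m) (monom 1 s * (\<Prod>j=1..m - s. [:- b j, 1:]))"
    using assms(1) p(2) by (intro exI[of _ "\<lambda>_. - complex_of_real k"]) simp
  ultimately show ?thesis
    unfolding zeros_in_disc_def using assms p(2) r by auto
qed

theorem corollary3p2:
  fixes k :: real and n m s :: nat
  assumes "0 < k" and "k \<le> 1"
  shows
    "(\<forall>(a :: nat \<Rightarrow> complex) (p :: complex poly) (r :: complex \<Rightarrow> complex).
        zeros_in_disc k n m s a p r \<longrightarrow>
        (\<forall>z :: complex. norm z = 1 \<longrightarrow>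
           norm (deriv r z) \<ge>
             1 / 2 * (norm (deriv (blaschke n a) z) - real n
               + 2 * (real m + real s * k) / (1 + k)
               + 2 * k / (k + 1)
                   * ((k ^ m * norm (coeff p m) - norm (coeff p s))
                      / (k ^ m * norm (coeff p m) + norm (coeff p s))))
             * norm (r z)))
     \<and>
     (s \<le> m \<and> m \<le> n \<longrightarrow>
      (\<forall>\<alpha> :: real. \<alpha> > 1 \<longrightarrow>
        (let a = (\<lambda>_ :: nat. complex_of_real \<alpha>);
             p = monom 1 s * [:complex_of_real k, 1:] ^ (m - s);
             r = (\<lambda>z :: complex. z ^ s * (z + of_real k) ^ (m - s) / (z - of_real \<alpha>) ^ n);
             B = (\<lambda>z :: complex. ((1 - of_real \<alpha> * z) / (z - of_real \<alpha>)) ^ n)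
         in zeros_in_disc k n m s a p r \<and> B = blaschke n a \<and>
            (norm (deriv r 1) =
               1 / 2 * (norm (deriv B 1) - real n
                 + 2 * (real m + real s * k) / (1 + k)
                 + 2 * k / (k + 1)
                     * ((k ^ m * norm (coeff p m) - norm (coeff p s))
                        / (k ^ m * norm (coeff p m) + norm (coeff p s))))
               * norm (r 1)
             \<longleftrightarrow> s = 0 \<or> k = 1))))"
proof (intro conjI allI impI, goal_cases)
  case (1 a p r z)
  then show ?case by (rule norm_deriv_rational_ge[OF assms])
next
  case (2 \<alpha>)
  then have sm: "s \<le> m" "m \<le> n" and \<alpha>: "\<alpha> > 1" by auto
  let ?a = "\<lambda>_ :: nat. complex_of_real \<alpha>"
  let ?p = "monom 1 s * [:complex_of_real k, 1:] ^ (m - s)"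
  let ?r = "\<lambda>z :: complex. z ^ s * (z + of_real k) ^ (m - s) / (z - of_real \<alpha>) ^ n"
  let ?B = "\<lambda>z :: complex. ((1 - of_real \<alpha> * z) / (z - of_real \<alpha>)) ^ n"
  let ?q = "(k ^ m * norm (coeff ?p m) - norm (coeff ?p s)) / (k ^ m * norm (coeff ?p m) + norm (coeff ?p s))"
  have B: "?B = blaschke n ?a" by (simp add: blaschke_def fun_eq_iff)
  have q: "?q = 0 \<longleftrightarrow> s = 0 \<or> k = 1"
    using extremal_quotient_eq_0_iff[OF assms sm(1)] assms
    by (simp add: extremal_poly[OF sm(1)] norm_power)
  have eq: "norm (deriv ?r 1) = 1 / 2 * (norm (deriv (blaschke n ?a) 1) - real n
      + 2 * (real m + real s * k) / (1 + k)) * norm (?r 1)" and r1: "?r 1 \<noteq> 0"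
    using norm_deriv_extremal_1[OF assms(1) \<alpha>, of s "m - s" n] sm by simp_all
  \<comment> \<open>\<open>X\<close> is the bound without the quotient term, already known to give
    |r'(1)|. As 2k / (k + 1) and \<open>R\<close> are nonzero, adding the term preserves equality
    only if \<open>Q = 0\<close>.\<close>
  have cancel: "1 / 2 * X * R = 1 / 2 * (X + 2 * k / (k + 1) * Q) * R \<longleftrightarrow> Q = 0"
    if "R \<noteq> 0" for X R Q :: real
    using that assms(1) by (simp add: field_simps)
  have "norm (deriv ?r 1) = 1 / 2 * (norm (deriv (blaschke n ?a) 1) - real n
      + 2 * (real m + real s * k) / (1 + k) + 2 * k / (k + 1) * ?q) * norm (?r 1) \<longleftrightarrow> ?q = 0"
    unfolding eq by (rule cancel) (use r1 in simp)
  then show ?case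
    unfolding Let_def B q using zeros_in_disc_extremal[OF assms(1) sm \<alpha>] by blast
qed

end
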